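(* For the set cover problem on simple set systems over a universe of size $n$, the greedy algorithm outputs a cover using at most $\left(\frac{\ln n}{2}+1\right)$ times the minimum number of sets. Further, there are simple set systems on which the greedy algorithm is off by a factor exceeding $\frac{\ln n}{2}-1$, i.e. it may output a cover using more than $\left(\frac{\ln n}{2}-1\right)$ times the minimum number of sets.
   Context: A set system $\mathcal{S}\subseteq 2^X$ over a universe $X=[n]$ is simple if $|S\cap S'|\le 1$ for all distinct $S,S'\in\mathcal{S}$. In the set cover problem one is given $\mathcal{S}$ whose union is $X$ and must choose a minimum number of sets from $\mathcal{S}$ whose union is $X$. The greedy algorithm repeatedly picks a set of $\mathcal{S}$ covering the maximum number of not-yet-covered elements (ties broken arbitrarily) until all of $X$ is covered. *)

theory Defs
  imports Complex_Main
begin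

definition simple_set_system :: "'a set \<Rightarrow> 'a set set \<Rightarrow> bool" where
  "simple_set_system X \<S> \<longleftrightarrow>
     \<S> \<subseteq> Pow X \<and> (\<forall>S\<in>\<S>. \<forall>S'\<in>\<S>. S \<noteq> S' \<longrightarrow> card (S \<inter> S') \<le> 1)"

definition set_cover :: "'a set \<Rightarrow> 'a set set \<Rightarrow> 'a set set \<Rightarrow> bool" where
  "set_cover X \<S> \<C> \<longleftrightarrow> \<C> \<subseteq> \<S> \<and> \<Union>\<C> = X"

text \<open>Only meaningful if \<open>\<S>\<close> is a finite system of sets with union \<open>X\<close>.\<close>

definition min_cover_size :: "'a set \<Rightarrow> 'a set set \<Rightarrow> nat" where
  "min_cover_size X \<S> = Min (card ` {\<C>. set_cover X \<S> \<C>})"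

text \<open>
  The states of the greedy algorithm: \<open>greedy_state X \<S> \<C>\<close> means that \<open>\<C>\<close> may be the
  collection of sets picked so far. The relation is nondeterministic, so every way of
  breaking ties is covered; the elements that a set \<open>T\<close> newly covers are \<open>T - \<Union>\<C>\<close>.
\<close>

inductive greedy_state :: "'a set \<Rightarrow> 'a set set \<Rightarrow> 'a set set \<Rightarrow> bool"
  for X :: "'a set" and \<S> :: "'a set set" where
  start: "greedy_state X \<S> {}"
| pick: "greedy_state X \<S> \<C> \<Longrightarrow> \<Union>\<C> \<noteq> X \<Longrightarrow>
    is_arg_max (\<lambda>T. card (T - \<Union>\<C>)) (\<lambda>T. T \<in> \<S>) T \<Longrightarrow> greedy_state X \<S> (insert T \<C>)"

definition greedy_output :: "'a set \<Rightarrow> 'a set set \<Rightarrow> 'a set set \<Rightarrow> bool" where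
  "greedy_output X \<S> \<C> \<longleftrightarrow> greedy_state X \<S> \<C> \<and> \<Union>\<C> = X"

end

theory Submission
  imports Defs
begin

text \<open>
  Upper bound: let \<open>k\<close> be the size of an optimal cover. Each pick covers at least a fraction
  \<open>1/k\<close> of what is left, so greedy uses at most \<open>\<Sum>m\<le>n. min 1 (k/m) \<le> k (1 + ln (n/k))\<close> sets,
  which settles \<open>k\<^sup>2 > n\<close>. By simplicity, a set outside the optimal cover has at most \<open>k\<close>
  elements, so a pick gaining more than \<open>k\<close> elements belongs to the optimal cover; hence
  charging the picks to the optimal sets costs each of them at most the harmonic number
  \<open>H\<^sub>k \<le> 1 + ln k\<close>, which settles \<open>k\<^sup>2 \<le> n\<close>.

  Lower bound: let \<open>k\<close> be the square root of \<open>n\<close>, rounded up. The \<open>k\<close> residue classes modulo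
  \<open>k\<close> form a cover. If \<open>{1..u}\<close> is what is left to cover, every class has at most
  \<open>\<lceil>u/k\<rceil>\<close> elements in it, so greedy may instead take the top \<open>\<lceil>u/k\<rceil> \<le> k\<close> elements of
  \<open>{1..u}\<close>, an interval meeting each class at most once. This shrinks \<open>u + k - 1\<close> by a factor of
  at least \<open>1 - 1/k\<close>, so about \<open>k ln (n/k)\<close> picks are needed.
\<close>

section \<open>The upper bound\<close>

text \<open>The summand is \<open>min 1 (k/m)\<close>; for \<open>k = 1\<close> these are the harmonic numbers.\<close>

definition capped_harm :: "nat \<Rightarrow> nat \<Rightarrow> real" where
  "capped_harm k u = (\<Sum>m=1..u. real k / real (max k m))"

lemma capped_harm_0 [simp]: "capped_harm k 0 = 0"
  by (simp add: capped_harm_def)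

lemma capped_harm_Suc [simp]:
  "capped_harm k (Suc u) = capped_harm k u + real k / real (max k (Suc u))"
  by (simp add: capped_harm_def)

lemma capped_harm_nonneg: "0 \<le> capped_harm k u"
  unfolding capped_harm_def by (intro sum_nonneg) simp

lemma capped_harm_mono: "u \<le> v \<Longrightarrow> capped_harm k u \<le> capped_harm k v"
  unfolding capped_harm_def by (intro sum_mono2) auto

text \<open>The summands do not increase with the index, so each of the last \<open>c\<close> is at
  least the final one.\<close>

lemma capped_harm_add:
  "capped_harm k u + real c * real k / real (max k (u + c)) \<le> capped_harm k (u + c)"
proof (cases "k = 0")
  case False
  have "capped_harm k u + real i * real k / real (max k (u + c)) \<le> capped_harm k (u + i)"
    if "i \<le> c" for i
    using that
  proof (induction i)
    case (Suc i)
    have "real k / real (max k (u + c)) \<le> real k / real (max k (Suc (u + i)))"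
      using False Suc.prems by (intro divide_left_mono) auto
    then show ?case
      using Suc by (simp add: add_divide_distrib distrib_right)
  qed simp
  then show ?thesis by simp
qed (simp add: capped_harm_def)

lemma capped_harm_diff:
  assumes "c \<le> u"
  shows "capped_harm k (u - c) + real c * real k / real (max k u) \<le> capped_harm k u"
  using capped_harm_add[of k "u - c" c] assms by simp

text \<open>The first \<open>k\<close> summands are 1; each later one is at most k times an
  increment of \<open>ln\<close>. The \<open>max\<close> makes the logarithm vanish for
  \<open>u \<le> k\<close>.\<close>

lemma capped_harm_le:
  assumes "k \<ge> 1"
  shows "capped_harm k u \<le> real k * (1 + ln (real (max k u) / real k))"
proof (cases "u \<le> k")
  case True
  have "capped_harm k u = (\<Sum>m=1..u. 1)"
    unfolding capped_harm_def using True assms by (intro sum.cong) auto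
  then show ?thesis using True assms by simp
next
  case False
  have *: "capped_harm k k = (\<Sum>m=1..k. 1)"
    unfolding capped_harm_def using assms by (intro sum.cong) auto
  from False have "k \<le> u" by simp
  then have "capped_harm k u \<le> real k * (1 + ln (real u / real k))"
  proof (induction rule: dec_induct)
    case base
    then show ?case using * assms by simp
  next
    case (step u)
    have pos: "real u > 0" using step assms by simp
    have "ln (real u / real (Suc u)) \<le> real u / real (Suc u) - 1"
      using pos by (intro ln_le_minus_one) simp
    also have "\<dots> = - (1 / real (Suc u))" by (simp add: field_simps)
    finally have "1 / real (Suc u) \<le> ln (real (Suc u)) - ln (real u)"
      using pos by (subst (asm) ln_div) auto
    then have "real k * (1 / real (Suc u)) \<le> real k * (ln (real (Suc u)) - ln (real u))"
      by (intro mult_left_mono) auto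
    moreover have "max k (Suc u) = Suc u" using step by simp
    moreover have "real k * ln (real v / real k) = real k * ln (real v) - real k * ln (real k)"
      if "v > 0" for v
      using that assms by (simp add: ln_div right_diff_distrib)
    from this[of u] this[of "Suc u"]
    have "real k * ln (real u / real k) = real k * ln (real u) - real k * ln (real k)"
      "real k * ln (real (Suc u) / real k) = real k * ln (real (Suc u)) - real k * ln (real k)"
      using pos by auto
    ultimately show ?case using step.IH
      unfolding capped_harm_Suc distrib_left right_diff_distrib by simp
  qed
  then show ?thesis using False by (simp add: max_def)
qed

section \<open>Greedy picks against an arbitrary cover\<close>

lemma greedy_state_subset: "greedy_state X \<S> \<C> \<Longrightarrow> \<C> \<subseteq> \<S>"
  by (induction rule: greedy_state.induct) (auto simp: is_arg_max_def)

lemma is_arg_max_card_ge: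
  "is_arg_max (\<lambda>T. card (T - A)) (\<lambda>T. T \<in> \<S>) T \<Longrightarrow> S \<in> \<S> \<Longrightarrow> card (S - A) \<le> card (T - A)"
  by (auto simp: is_arg_max_def not_less)

text \<open>Averaging: the sets of the cover share the uncovered elements, and none of them gains
  more than \<open>T\<close>.\<close>

lemma greedy_pick_gain:
  assumes "finite X" "\<S> \<subseteq> Pow X" "set_cover X \<S> \<O>"
    and "is_arg_max (\<lambda>T. card (T - A)) (\<lambda>T. T \<in> \<S>) T"
  shows "card (X - A) \<le> card \<O> * card (T - A)"
proof -
  have fin: "finite \<O>" using assms unfolding set_cover_def by (meson finite_Pow_iff finite_subset)
  have "X - A = (\<Union>S\<in>\<O>. S - A)" using assms by (auto simp: set_cover_def)
  then have "card (X - A) \<le> (\<Sum>S\<in>\<O>. card (S - A))" using card_UN_le[OF fin] by metis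
  also have "\<dots> \<le> (\<Sum>S\<in>\<O>. card (T - A))"
    using assms by (intro sum_mono is_arg_max_card_ge[OF assms(4)]) (auto simp: set_cover_def)
  finally show ?thesis by simp
qed

text \<open>Potential argument: a pick covering c of u open elements lowers
  \<open>capped_harm\<close> by at least \<open>c * k / max k u\<close>, which is at least 1 because
  \<open>u \<le> k * c\<close> and \<open>c \<ge> 1\<close>.\<close>

lemma greedy_state_card_le:
  assumes "finite X" "\<S> \<subseteq> Pow X" "set_cover X \<S> \<O>" "greedy_state X \<S> \<C>"
  shows "real (card \<C>) + capped_harm (card \<O>) (card (X - \<Union>\<C>)) \<le> capped_harm (card \<O>) (card X)"
  using assms(4)
proof (induction rule: greedy_state.induct)
  case (pick \<C> T)
  let ?k = "card \<O>" and ?u = "card (X - \<Union>\<C>)" and ?c = "card (T - \<Union>\<C>)"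
  have T: "T \<subseteq> X" using pick(3) assms(2) by (auto simp: is_arg_max_def)
  have "\<Union>\<C> \<subseteq> X" using greedy_state_subset[OF pick(1)] assms(2) by auto
  then have upos: "?u > 0" using pick(2) assms(1) by (auto simp: card_gt_0_iff)
  have gain: "?u \<le> ?k * ?c" by (rule greedy_pick_gain[OF assms(1-3) pick(3)])
  then have "?k * ?c > 0" using upos by linarith
  then have pos: "?c \<ge> 1" "?k \<ge> 1" by (auto simp: Suc_le_eq)
  then have "max ?k ?u \<le> ?k * ?c" using gain by simp
  then have "real (max ?k ?u) \<le> real ?c * real ?k"
    by (metis mult.commute of_nat_le_iff of_nat_mult)
  then have "1 \<le> real ?c * real ?k / real (max ?k ?u)"
    using pos by (simp add: le_divide_eq)
  moreover have "?c \<le> ?u" using T assms(1) by (intro card_mono) auto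
  moreover have "X - \<Union>(insert T \<C>) = (X - \<Union>\<C>) - (T - \<Union>\<C>)" by auto
  then have "card (X - \<Union>(insert T \<C>)) = ?u - ?c"
    using T assms(1) by (simp only:) (intro card_Diff_subset; auto intro: finite_subset)
  moreover have "card (insert T \<C>) \<le> Suc (card \<C>)" by (rule card_insert_le_m1) auto
  ultimately show ?case
    using pick.IH capped_harm_diff[of ?c ?u ?k] by simp
qed simp

section \<open>Charging picks to the sets of a cover of a simple system\<close>

lemma simple_set_system_card_le:
  assumes "finite X" "simple_set_system X \<S>" "set_cover X \<S> \<O>" "T \<in> \<S>" "T \<notin> \<O>"
  shows "card T \<le> card \<O>"
proof -
  have "finite \<S>" using assms unfolding simple_set_system_def by (meson finite_Pow_iff finite_subset)
  then have fin: "finite \<O>" using assms unfolding set_cover_def by (meson finite_subset)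
  have "T = (\<Union>S\<in>\<O>. T \<inter> S)"
    using assms by (fastforce simp: set_cover_def simple_set_system_def)
  then have "card T \<le> (\<Sum>S\<in>\<O>. card (T \<inter> S))" using card_UN_le[OF fin] by metis
  also have "\<dots> \<le> (\<Sum>S\<in>\<O>. 1)"
  proof (rule sum_mono)
    fix S assume "S \<in> \<O>"
    then have "S \<in> \<S>" "T \<noteq> S" using assms by (auto simp: set_cover_def)
    then show "card (T \<inter> S) \<le> 1" using assms(2,4) by (simp add: simple_set_system_def)
  qed
  finally show ?thesis by simp
qed

text \<open>Each set of the cover holds as potential the harmonic number of its uncovered size,
  truncated at \<open>card \<O>\<close> to keep the initial total small. Every pick lowers the total
  by at least 1: small gains are paid jointly by the sets of the cover, larger ones by the picked
  set alone.\<close>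

lemma simple_greedy_state_card_le:
  assumes "finite X" "simple_set_system X \<S>" "set_cover X \<S> \<O>" "greedy_state X \<S> \<C>"
  shows "real (card \<C>) + (\<Sum>S\<in>\<O>. capped_harm 1 (min (card \<O>) (card (S - \<Union>\<C>))))
    \<le> real (card \<O>) * capped_harm 1 (card \<O>)"
  using assms(4)
proof (induction rule: greedy_state.induct)
  case start
  have "(\<Sum>S\<in>\<O>. capped_harm 1 (min (card \<O>) (card S))) \<le> (\<Sum>S\<in>\<O>. capped_harm 1 (card \<O>))"
    by (intro sum_mono capped_harm_mono) auto
  then show ?case by simp
next
  case (pick \<C> T)
  let ?k = "card \<O>" and ?c = "card (T - \<Union>\<C>)"
  let ?h = "\<lambda>\<C> S. capped_harm 1 (min ?k (card (S - \<Union>\<C>)))"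
  have sub: "\<S> \<subseteq> Pow X" using assms(2) by (simp add: simple_set_system_def)
  have finO: "finite \<O>" using assms(1,3) sub unfolding set_cover_def by (meson finite_Pow_iff finite_subset)
  have TS: "T \<in> \<S>" using pick(3) by (auto simp: is_arg_max_def)
  have OX: "S \<subseteq> X" if "S \<in> \<O>" for S using that assms(3) by (auto simp: set_cover_def)
  have finT: "finite T" using TS sub assms(1) by (meson PowD finite_subset subsetD)
  have finS: "finite S" if "S \<in> \<O>" for S using OX[OF that] assms(1) by (rule finite_subset)
  have "\<Union>\<C> \<subseteq> X" using greedy_state_subset[OF pick(1)] sub by auto
  then have "card (X - \<Union>\<C>) > 0" using pick(2) assms(1) by (auto simp: card_gt_0_iff)
  with greedy_pick_gain[OF assms(1) sub assms(3) pick(3)] have "?k * ?c > 0" by linarith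
  then have pos: "?c \<ge> 1" "?k \<ge> 1" by (auto simp: Suc_le_eq)
  have mono: "?h (insert T \<C>) S \<le> ?h \<C> S" if "S \<in> \<O>" for S
    using finS[OF that] by (intro capped_harm_mono min.mono order_refl card_mono) (auto simp: finO)
  have "1 + (\<Sum>S\<in>\<O>. ?h (insert T \<C>) S) \<le> (\<Sum>S\<in>\<O>. ?h \<C> S)"
  proof (cases "?c \<le> ?k")
    case True
    \<comment> \<open>Maximality gives \<open>?a \<le> ?c \<le> ?k\<close>, so neither truncation is
      active, and every lost harmonic summand is at least \<open>1 / ?c\<close>.\<close>
    have drop: "?h (insert T \<C>) S + real (card (S \<inter> (T - \<Union>\<C>))) / real ?c \<le> ?h \<C> S"
      if S: "S \<in> \<O>" for S
    proof -
      let ?a = "card (S - \<Union>\<C>)" and ?b = "card (S \<inter> (T - \<Union>\<C>))"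
      have a: "?a \<le> ?c" using S assms(3)
        by (intro is_arg_max_card_ge[OF pick(3)]) (auto simp: set_cover_def)
      have "S - \<Union>(insert T \<C>) = (S - \<Union>\<C>) - (S \<inter> (T - \<Union>\<C>))" by auto
      then have "card (S - \<Union>(insert T \<C>)) = ?a - ?b"
        using finS[OF S] by (simp only:) (intro card_Diff_subset; auto)
      moreover have "?b \<le> ?a" using finS[OF S] by (intro card_mono) auto
      moreover have "real ?b / real ?c \<le> real ?b / real (max 1 ?a)"
        using a pos by (intro divide_left_mono) auto
      ultimately show ?thesis
        using capped_harm_diff[of ?b ?a 1] a True
        by (simp add: min.absorb2)
    qed
    have "T - \<Union>\<C> = (\<Union>S\<in>\<O>. S \<inter> (T - \<Union>\<C>))"
      using TS sub assms(3) by (auto simp: set_cover_def)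
    then have "?c \<le> (\<Sum>S\<in>\<O>. card (S \<inter> (T - \<Union>\<C>)))"
      using card_UN_le[OF finO] by metis
    then have "real ?c \<le> (\<Sum>S\<in>\<O>. real (card (S \<inter> (T - \<Union>\<C>))))"
      by (metis of_nat_le_iff of_nat_sum)
    then have "1 \<le> (\<Sum>S\<in>\<O>. real (card (S \<inter> (T - \<Union>\<C>)))) / real ?c"
      using pos by (simp add: le_divide_eq)
    also have "\<dots> = (\<Sum>S\<in>\<O>. real (card (S \<inter> (T - \<Union>\<C>))) / real ?c)"
      by (simp add: sum_divide_distrib)
    finally have "1 + (\<Sum>S\<in>\<O>. ?h (insert T \<C>) S)
        \<le> (\<Sum>S\<in>\<O>. ?h (insert T \<C>) S + real (card (S \<inter> (T - \<Union>\<C>))) / real ?c)"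
      by (simp add: sum.distrib)
    also have "\<dots> \<le> (\<Sum>S\<in>\<O>. ?h \<C> S)" by (intro sum_mono drop)
    finally show ?thesis .
  next
    case False
    have "?c \<le> card T" using finT by (intro card_mono) auto
    then have TO: "T \<in> \<O>"
      using simple_set_system_card_le[OF assms(1-3) TS] False by linarith
    \<comment> \<open>\<open>T\<close> pays alone: its term falls from the full
      \<open>capped_harm 1 ?k\<close>, which is at least 1, to 0.\<close>
    have "capped_harm 1 1 \<le> capped_harm 1 ?k" using pos by (intro capped_harm_mono) auto
    moreover have "?h \<C> T = capped_harm 1 ?k" using False by (simp add: min_def)
    moreover have "T - \<Union>(insert T \<C>) = {}" by auto
    then have "?h (insert T \<C>) T = 0" by (simp only:) simp
    ultimately have "1 + ?h (insert T \<C>) T \<le> ?h \<C> T" by (simp add: capped_harm_def)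
    moreover have "(\<Sum>S\<in>\<O>-{T}. ?h (insert T \<C>) S) \<le> (\<Sum>S\<in>\<O>-{T}. ?h \<C> S)"
      by (intro sum_mono mono) auto
    ultimately show ?thesis
      by (simp only: sum.remove[OF finO TO])
  qed
  moreover have "card (insert T \<C>) \<le> Suc (card \<C>)" by (rule card_insert_le_m1) auto
  ultimately show ?case using pick.IH by linarith
qed

text \<open>The two estimates k (1 + ln k) and k (1 + ln (n/k)) cross at k^2 = n, where both
  logarithms equal half of ln n; on either side the smaller one is used.\<close>

lemma simple_greedy_output_card_le:
  assumes "finite X" "X \<noteq> {}" "simple_set_system X \<S>" "set_cover X \<S> \<O>" "greedy_state X \<S> \<C>"
  shows "real (card \<C>) \<le> (ln (real (card X)) / 2 + 1) * real (card \<O>)"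
proof -
  let ?n = "card X" and ?k = "card \<O>"
  have sub: "\<S> \<subseteq> Pow X" using assms(3) by (simp add: simple_set_system_def)
  have "finite \<O>" using assms(1,4) sub unfolding set_cover_def by (meson finite_Pow_iff finite_subset)
  moreover have "\<O> \<noteq> {}" using assms(2,4) by (auto simp: set_cover_def)
  ultimately have k: "?k \<ge> 1" by (simp add: Suc_le_eq card_gt_0_iff)
  have n: "?n \<ge> 1" using assms(1,2) by (simp add: Suc_le_eq card_gt_0_iff)
  have "real (card \<C>) \<le> real ?k * (1 + ln (real ?n) / 2)"
  proof (cases "?k\<^sup>2 \<le> ?n")
    case True
    then have "ln (real ?k ^ 2) \<le> ln (real ?n)"
      using k n by (subst ln_le_cancel_iff) (auto simp flip: of_nat_power)
    then have ln: "ln (real ?k) \<le> ln (real ?n) / 2" using k by (simp add: ln_realpow)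
    have "0 \<le> (\<Sum>S\<in>\<O>. capped_harm 1 (min ?k (card (S - \<Union>\<C>))))"
      by (intro sum_nonneg capped_harm_nonneg)
    then have "real (card \<C>) \<le> real ?k * capped_harm 1 ?k"
      using simple_greedy_state_card_le[OF assms(1,3-5)] by linarith
    also have "\<dots> \<le> real ?k * (1 + ln (real ?n) / 2)"
      using capped_harm_le[of 1 ?k] k ln by (intro mult_left_mono) (auto simp: max_def)
    finally show ?thesis .
  next
    case False
    then have "real ?n \<le> real ?k ^ 2" by (simp flip: of_nat_power)
    then have "ln (real ?n) \<le> ln (real ?k ^ 2)" using k n by (subst ln_le_cancel_iff) auto
    then have ln: "ln (real ?n) / 2 \<le> ln (real ?k)" using k by (simp add: ln_realpow)
    have "ln (real (max ?k ?n) / real ?k) \<le> ln (real ?n) / 2"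
      using ln k n by (cases "?k \<le> ?n") (auto simp: max_def ln_div)
    then have "real ?k * (1 + ln (real (max ?k ?n) / real ?k)) \<le> real ?k * (1 + ln (real ?n) / 2)"
      by (intro mult_left_mono) auto
    then show ?thesis
      using greedy_state_card_le[OF assms(1) sub assms(4,5)] capped_harm_le[OF k, of ?n]
        capped_harm_nonneg[of ?k "card (X - \<Union>\<C>)"] by linarith
  qed
  then show ?thesis by (simp add: algebra_simps)
qed

section \<open>Existence of greedy outputs and of minimum covers\<close>

lemma greedy_output_exists:
  assumes "finite X" "\<S> \<subseteq> Pow X" "\<Union>\<S> = X"
  shows "\<exists>\<C>. greedy_output X \<S> \<C>"
proof -
  have finS: "finite \<S>" using assms by (meson finite_Pow_iff finite_subset)
  have "\<exists>\<C>'. greedy_output X \<S> \<C>'" if "greedy_state X \<S> \<C>" for \<C>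
    using that
  proof (induction "card (X - \<Union>\<C>)" arbitrary: \<C> rule: less_induct)
    case less
    show ?case
    proof (cases "\<Union>\<C> = X")
      case True
      then show ?thesis using less.prems by (auto simp: greedy_output_def)
    next
      case False
      let ?f = "\<lambda>T. card (T - \<Union>\<C>)"
      have sub: "\<Union>\<C> \<subseteq> X" using greedy_state_subset[OF less.prems] assms(2) by auto
      then have ne: "X - \<Union>\<C> \<noteq> {}" using False by auto
      then have "\<S> \<noteq> {}" using assms(3) by auto
      then have "Max (?f ` \<S>) \<in> ?f ` \<S>" using finS by (intro Max_in) auto
      then obtain T where T: "T \<in> \<S>" "Max (?f ` \<S>) = ?f T" by auto
      then have "\<forall>S\<in>\<S>. ?f S \<le> ?f T" using finS by (metis Max_ge finite_imageI imageI)
      then have am: "is_arg_max ?f (\<lambda>T. T \<in> \<S>) T"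
        using T(1) by (auto simp: is_arg_max_def not_less)
      \<comment> \<open>Comparing with the whole system as a cover shows that the pick gains
        something, so the number of uncovered elements falls.\<close>
      have "set_cover X \<S> \<S>" using assms(3) by (simp add: set_cover_def)
      then have "card (X - \<Union>\<C>) \<le> card \<S> * ?f T"
        using greedy_pick_gain[OF assms(1,2) _ am] by blast
      moreover have "card (X - \<Union>\<C>) > 0" using ne assms(1) by (simp add: card_gt_0_iff)
      ultimately have "card \<S> * ?f T > 0" by linarith
      then have "T - \<Union>\<C> \<noteq> {}" by (metis card.empty less_irrefl mult_0_right)
      then have "X - \<Union>(insert T \<C>) \<subset> X - \<Union>\<C>" using T(1) assms(2) by auto
      then have "card (X - \<Union>(insert T \<C>)) < card (X - \<Union>\<C>)"
        using assms(1) by (intro psubset_card_mono) auto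
      then show ?thesis
        using less.hyps greedy_state.pick[OF less.prems False am] by blast
    qed
  qed
  then show ?thesis using greedy_state.start by blast
qed

lemma finite_set_covers:
  assumes "finite X" "\<S> \<subseteq> Pow X"
  shows "finite {\<C>. set_cover X \<S> \<C>}"
proof (rule finite_subset)
  show "{\<C>. set_cover X \<S> \<C>} \<subseteq> Pow \<S>" by (auto simp: set_cover_def)
  show "finite (Pow \<S>)" using assms by (meson finite_Pow_iff finite_subset)
qed

lemma min_cover_size_le:
  assumes "finite X" "\<S> \<subseteq> Pow X" "set_cover X \<S> \<C>"
  shows "min_cover_size X \<S> \<le> card \<C>"
  unfolding min_cover_size_def using finite_set_covers[OF assms(1,2)] assms(3)
  by (intro Min_le) auto

lemma min_cover_size_attained:
  assumes "finite X" "\<S> \<subseteq> Pow X" "\<Union>\<S> = X"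
  obtains \<C> where "set_cover X \<S> \<C>" "card \<C> = min_cover_size X \<S>"
proof -
  have "set_cover X \<S> \<S>" using assms(3) by (simp add: set_cover_def)
  then have "min_cover_size X \<S> \<in> card ` {\<C>. set_cover X \<S> \<C>}"
    unfolding min_cover_size_def using finite_set_covers[OF assms(1,2)]
    by (intro Min_in) auto
  then show ?thesis using that by auto
qed

section \<open>The lower bound\<close>

text \<open>For \<open>k \<ge> 1\<close> the number \<open>(u + k - 1) div k\<close> is \<open>u/k\<close> rounded up.\<close>

fun rest :: "nat \<Rightarrow> nat \<Rightarrow> nat \<Rightarrow> nat" where
  "rest k n 0 = n"
| "rest k n (Suc i) = rest k n i - (rest k n i + k - 1) div k"

text \<open>The top elements of \<open>{1..rest k n i}\<close>: the pick that takes the run from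
  \<open>i\<close> to \<open>i + 1\<close> sets.\<close>

definition block :: "nat \<Rightarrow> nat \<Rightarrow> nat \<Rightarrow> nat set" where
  "block k n i = {rest k n (Suc i)<..rest k n i}"

text \<open>The shift numbers the universe from 0, so that \<open>x\<close> is determined by
  \<open>j\<close> and the quotient \<open>(x - 1) div k\<close>.\<close>

definition residue_class :: "nat \<Rightarrow> nat \<Rightarrow> nat \<Rightarrow> nat set" where
  "residue_class k n j = {x\<in>{1..n}. (x - 1) mod k = j}"

text \<open>Guarantees that the natural subtraction in \<open>rest\<close> is never cut off at
  0.\<close>

lemma ceil_div_le:
  fixes k u :: nat
  assumes "k \<ge> 1"
  shows "(u + k - 1) div k \<le> u"
proof (cases u)
  case (Suc v)
  then have "(u + k - 1) div k = v div k + 1" using assms by simp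
  also have "\<dots> \<le> u" using Suc div_le_dividend[of v k] by simp
  finally show ?thesis .
qed (use assms in simp)

lemma card_block: "k \<ge> 1 \<Longrightarrow> card (block k n i) = (rest k n i + k - 1) div k"
  using ceil_div_le[of k "rest k n i"] by (simp add: block_def)

lemma rest_antimono: "i \<le> j \<Longrightarrow> rest k n j \<le> rest k n i"
  by (induction rule: dec_induct) (auto intro: order_trans diff_le_self)

lemma rest_le: "rest k n i \<le> n"
  using rest_antimono[of 0 i k n] by simp

lemma rest_less:
  assumes "k \<ge> 1" "rest k n i > 0"
  shows "rest k n (Suc i) < rest k n i"
proof -
  have "(rest k n i + k - 1) div k > 0" using assms by (simp add: div_greater_zero_iff)
  then show ?thesis using assms(2) by simp
qed

lemma rest_eventually_0:
  assumes "k \<ge> 1"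
  shows "rest k n n = 0"
proof -
  have "rest k n i \<le> n - i" for i
  proof (induction i)
    case (Suc i)
    then show ?case using rest_less[OF assms, of n i]
      by (cases "rest k n i = 0") (auto simp del: rest.simps(2) simp: rest_antimono[of i "Suc i" k n, THEN le_trans])
  qed simp
  from this[of n] show ?thesis by simp
qed

lemma Union_blocks: "(\<Union>i<m. block k n i) = {rest k n m<..n}"
proof (induction m)
  case (Suc m)
  have "rest k n (Suc m) \<le> rest k n m" "rest k n m \<le> n"
    by (auto intro: rest_antimono rest_le)
  then show ?case
    using Suc by (auto simp: lessThan_Suc block_def simp del: rest.simps(2))
qed simp

lemma block_disjoint: "i \<noteq> j \<Longrightarrow> block k n i \<inter> block k n j = {}"
proof (induction i j rule: linorder_wlog)
  case (le i j)
  then have "rest k n j \<le> rest k n (Suc i)" by (intro rest_antimono) auto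
  then show ?case by (auto simp: block_def simp del: rest.simps(2))
qed (auto simp: Int_commute)

text \<open>Bounds the gain of a class by the size of the competing block: within a class the
  quotients are distinct and lie below u/k rounded up.\<close>

lemma card_residue_class_le:
  assumes "k \<ge> 1"
  shows "card {x\<in>{1..u}. (x - 1) mod k = j} \<le> (u + k - 1) div k"
proof -
  let ?A = "{x\<in>{1..u}. (x - 1) mod k = j}" and ?f = "\<lambda>x. (x - 1) div k"
  have "inj_on ?f ?A"
  proof (rule inj_onI)
    fix x y assume *: "x \<in> ?A" "y \<in> ?A" "?f x = ?f y"
    then have "x - 1 = y - 1" by (metis (mono_tags, lifting) div_mult_mod_eq mem_Collect_eq)
    then show "x = y" using * by auto
  qed
  moreover have "?f ` ?A \<subseteq> {..<(u + k - 1) div k}"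
  proof (rule image_subsetI)
    fix x assume "x \<in> ?A"
    \<comment> \<open>Adding \<open>k\<close> raises the quotient by one, which turns the weak
      inequality of \<open>div_le_mono\<close> into the strict one.\<close>
    then have "(x - 1) + k \<le> u + k - 1" by auto
    then have "((x - 1) + k) div k \<le> (u + k - 1) div k" by (rule div_le_mono)
    then show "?f x \<in> {..<(u + k - 1) div k}" using assms by simp
  qed
  ultimately have "card ?A \<le> card {..<(u + k - 1) div k}" by (intro card_inj_on_le) auto
  then show ?thesis by simp
qed

text \<open>As \<open>n \<le> k\<^sup>2\<close>, a block consists of at most \<open>k\<close>
  consecutive numbers, while distinct members of a class differ by at least
  \<open>k\<close>.\<close>

lemma residue_class_Int_block:
  assumes "k \<ge> 1" "n \<le> k\<^sup>2"
  shows "card (residue_class k n j \<inter> block k n i) \<le> 1"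
proof -
  have "(rest k n i + k - 1) div k \<le> (k * k + (k - 1)) div k"
    using rest_le[of k n i] assms by (intro div_le_mono) (simp add: power2_eq_square)
  also have "\<dots> = k" using assms(1) by (subst div_mult_self3) auto
  finally have len: "rest k n i \<le> rest k n (Suc i) + k" by simp
  have "x \<le> y" if "x \<in> residue_class k n j \<inter> block k n i" "y \<in> residue_class k n j \<inter> block k n i" for x y
  proof (rule ccontr)
    assume "\<not> x \<le> y"
    then have less: "y - 1 < x - 1" "x - y < k" "x - 1 - (y - 1) = x - y"
      using that len by (auto simp: residue_class_def block_def simp del: rest.simps(2))
    have "(x - 1) mod k = (y - 1) mod k" using that by (auto simp: residue_class_def)
    then have "k dvd (x - 1) - (y - 1)" using less(1) by (simp add: mod_eq_dvd_iff_nat)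
    then show False using less by (auto dest: dvd_imp_le)
  qed
  then have "\<forall>x\<in>residue_class k n j \<inter> block k n i. \<forall>y\<in>residue_class k n j \<inter> block k n i. x = y"
    by (blast intro: antisym)
  moreover have "finite (residue_class k n j \<inter> block k n i)" by (simp add: block_def)
  ultimately show ?thesis by (simp only: One_nat_def card_le_Suc0_iff_eq)
qed

text \<open>The classes provide the small cover, the blocks the sets that lure greedy away from it.
  \<open>m\<close> is later chosen as the number of blocks that exhausts the universe.\<close>

definition bad_system :: "nat \<Rightarrow> nat \<Rightarrow> nat \<Rightarrow> nat set set" where
  "bad_system k n m = residue_class k n ` {..<k} \<union> block k n ` {..<m}"

lemma bad_system_subset: "bad_system k n m \<subseteq> Pow {1..n}"
proof -
  have "block k n i \<subseteq> {1..n}" for i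
    using rest_le[of k n i] by (auto simp: block_def simp del: rest.simps(2))
  then show ?thesis by (auto simp: bad_system_def residue_class_def)
qed

lemma simple_bad_system:
  assumes "k \<ge> 1" "n \<le> k\<^sup>2"
  shows "simple_set_system {1..n} (bad_system k n m)"
  unfolding simple_set_system_def
proof (intro conjI ballI impI)
  fix S S' assume *: "S \<in> bad_system k n m" "S' \<in> bad_system k n m" "S \<noteq> S'"
  \<comment> \<open>Serves both families: equal indices contradict \<open>S \<noteq> S'\<close>,
    different ones give disjoint sets.\<close>
  have disj: "card (A i \<inter> A j) \<le> 1" if "S = A i" "S' = A j" "i \<noteq> j \<Longrightarrow> A i \<inter> A j = {}"
    for A :: "nat \<Rightarrow> nat set" and i j
    using that \<open>S \<noteq> S'\<close> by (cases "i = j") simp_all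
  have res: "residue_class k n i \<inter> residue_class k n j = {}" if "i \<noteq> j" for i j
    using that by (auto simp: residue_class_def)
  have cross: "card (residue_class k n j \<inter> block k n i) \<le> 1" for i j
    by (rule residue_class_Int_block[OF assms])
  show "card (S \<inter> S') \<le> 1"
    using *(1,2) unfolding bad_system_def
  proof (elim UnE imageE)
    fix i j assume S: "S = residue_class k n i" "S' = residue_class k n j"
    show ?thesis unfolding S by (rule disj[of "residue_class k n", OF S res])
  next
    fix i j assume S: "S = residue_class k n i" "S' = block k n j"
    show ?thesis unfolding S by (rule cross)
  next
    fix i j assume S: "S = block k n i" "S' = residue_class k n j"
    show ?thesis unfolding S Int_commute[of "block k n i"] by (rule cross)
  next
    fix i j assume S: "S = block k n i" "S' = block k n j"
    show ?thesis unfolding S by (rule disj[of "block k n", OF S block_disjoint])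
  qed
qed (rule bad_system_subset)

lemma set_cover_residue_classes:
  assumes "k \<ge> 1"
  shows "set_cover {1..n} (bad_system k n m) (residue_class k n ` {..<k})"
  using assms by (auto simp: set_cover_def bad_system_def residue_class_def)

text \<open>With \<open>{1..rest k n i}\<close> uncovered, \<open>block k n i\<close> gains all its
  elements. Classes gain no more, earlier blocks gain nothing, and later blocks are no larger; ties
  go to the block. Positivity keeps the run from having ended.\<close>

lemma greedy_state_blocks:
  assumes "k \<ge> 1" "i \<le> m" and pos: "\<And>i. i < m \<Longrightarrow> rest k n i > 0"
  shows "greedy_state {1..n} (bad_system k n m) (block k n ` {..<i})"
  using assms(2)
proof (induction i)
  case 0
  then show ?case by (simp add: greedy_state.start)
next
  case (Suc i)
  let ?C = "block k n ` {..<i}"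
  have U: "\<Union>?C = {rest k n i<..n}" using Union_blocks[of k n i] by simp
  have "rest k n i \<in> {1..n} - \<Union>?C" using pos[of i] Suc.prems rest_le[of k n i] by (auto simp: U)
  then have ne: "\<Union>?C \<noteq> {1..n}" by blast
  have "block k n i - \<Union>?C = block k n i" unfolding U by (auto simp: block_def)
  then have c: "card (block k n i - \<Union>?C) = (rest k n i + k - 1) div k"
    using card_block[OF assms(1)] by simp
  have "card (S - \<Union>?C) \<le> (rest k n i + k - 1) div k" if "S \<in> bad_system k n m" for S
    using that unfolding bad_system_def
  proof (elim UnE imageE)
    fix j assume S: "S = residue_class k n j"
    have "card (S - \<Union>?C) \<le> card {x\<in>{1..rest k n i}. (x - 1) mod k = j}"
      unfolding U S by (intro card_mono) (auto simp: residue_class_def)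
    then show ?thesis using card_residue_class_le[OF assms(1)] by (rule le_trans)
  next
    fix j assume S: "S = block k n j"
    show ?thesis
    proof (cases "j < i")
      case True
      then have "S - \<Union>?C = {}" using S by auto
      then show ?thesis by (metis card.empty le0)
    next
      case False
      have "card (S - \<Union>?C) \<le> card S" by (intro card_mono) (auto simp: S block_def)
      also have "\<dots> = (rest k n j + k - 1) div k" using S card_block[OF assms(1)] by simp
      also have "\<dots> \<le> (rest k n i + k - 1) div k"
        using rest_antimono[of i j k n] False by (intro div_le_mono diff_le_mono) auto
      finally show ?thesis .
    qed
  qed
  moreover have "block k n i \<in> bad_system k n m" using Suc.prems by (auto simp: bad_system_def)
  ultimately have "is_arg_max (\<lambda>T. card (T - \<Union>?C)) (\<lambda>T. T \<in> bad_system k n m) (block k n i)"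
    using c by (simp add: is_arg_max_def not_less)
  then have "greedy_state {1..n} (bad_system k n m) (insert (block k n i) ?C)"
    using Suc ne by (intro greedy_state.pick) auto
  then show ?case by (simp add: lessThan_Suc)
qed

lemma card_blocks:
  assumes "k \<ge> 1" and pos: "\<And>i. i < m \<Longrightarrow> rest k n i > 0"
  shows "card (block k n ` {..<m}) = m"
proof -
  have "inj_on (block k n) {..<m}"
  proof (rule inj_onI)
    fix i j assume *: "i \<in> {..<m}" "j \<in> {..<m}" "block k n i = block k n j"
    have "rest k n i \<in> block k n i"
      using rest_less[OF assms(1) pos, of i] *(1) by (simp add: block_def del: rest.simps(2))
    then show "i = j" using *(3) block_disjoint[of i j k n] by blast
  qed
  then show ?thesis by (simp add: card_image)
qed

section \<open>Length of the bad greedy run\<close>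

text \<open>With k = q + 1 the pick from u elements has size at most (u + q)/(q + 1). The offset
  \<open>q\<close> absorbs the rounding, so u + q keeps at least the fraction q/(q + 1).\<close>

lemma rest_ge:
  assumes "q \<ge> 1"
  shows "(real n + real q) * (real q / real (Suc q)) ^ i \<le> real (rest (Suc q) n i) + real q"
proof (induction i)
  case (Suc i)
  let ?u = "rest (Suc q) n i" and ?r = "real q / real (Suc q)"
  let ?c = "(?u + q) div Suc q"
  have c: "rest (Suc q) n (Suc i) = ?u - ?c" "?c \<le> ?u"
    using ceil_div_le[of "Suc q" ?u] by simp_all
  have "real ?c \<le> real (?u + q) / real (Suc q)" by (rule of_nat_div_le_of_nat)
  then have "(real ?u + real q) * ?r \<le> real (?u - ?c) + real q"
    using c(2) by (simp add: of_nat_diff field_simps)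
  moreover have "(real n + real q) * ?r ^ i * ?r \<le> (real ?u + real q) * ?r"
    by (intro mult_right_mono Suc.IH) auto
  ultimately show ?case unfolding c(1) power_Suc2 mult.assoc[symmetric] by (rule order_trans[rotated])
qed simp

text \<open>At rest 0 the geometric bound yields n <= q (1 + 1/q)^m <= q exp (m/q), hence ln n <= ln
  q + m/q, and \<open>q\<^sup>2 \<le> n\<close> bounds ln q by half of ln n.\<close>

lemma rest_0_imp_ge:
  assumes "q \<ge> 1" "n \<ge> 1" "q\<^sup>2 \<le> n" "rest (Suc q) n m = 0"
  shows "real q * (ln (real n) / 2) \<le> real m"
proof -
  have q: "real q > 0" using assms by simp
  have "real n + real q \<le> real q * (real (Suc q) / real q) ^ m"
    using rest_ge[OF assms(1), of n m] assms(4) q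
    by (simp add: power_divide field_simps)
  also have "real (Suc q) / real q = 1 + 1 / real q" using q by (simp add: field_simps)
  also have "real q * (1 + 1 / real q) ^ m \<le> real q * exp (1 / real q) ^ m"
    by (intro mult_left_mono power_mono) auto
  also have "exp (1 / real q) ^ m = exp (real m / real q)"
    by (simp flip: exp_of_nat_mult)
  finally have "real n \<le> real q * exp (real m / real q)" using q by linarith
  then have "ln (real n) \<le> ln (real q * exp (real m / real q))"
    using assms(2) q by (subst ln_le_cancel_iff) auto
  also have "\<dots> = ln (real q) + real m / real q" using q by (simp add: ln_mult)
  finally have 1: "ln (real n) \<le> ln (real q) + real m / real q" .
  have "ln (real q ^ 2) \<le> ln (real n)"
    using assms q by (subst ln_le_cancel_iff) (auto simp flip: of_nat_power)
  then have "2 * ln (real q) \<le> ln (real n)" using q by (simp add: ln_realpow)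
  with 1 have "ln (real n) / 2 \<le> real m / real q" by linarith
  then show ?thesis using q by (simp add: field_simps)
qed

text \<open>The upper estimate on \<open>n\<close> makes the bad system simple; the lower one makes
  its greedy run long.\<close>

lemma ceil_sqrt_exists:
  fixes n :: nat
  assumes "n \<ge> 1"
  obtains q where "q\<^sup>2 < n" "n \<le> (Suc q)\<^sup>2"
proof -
  define k where "k = (LEAST k. n \<le> k\<^sup>2)"
  have "n \<le> n\<^sup>2" by (simp add: power2_eq_square)
  then have k: "n \<le> k\<^sup>2" unfolding k_def by (rule LeastI)
  then obtain q where q: "k = Suc q" using assms by (cases k) auto
  then have "\<not> n \<le> q\<^sup>2" unfolding k_def by (intro not_less_Least) simp
  then show ?thesis using that[of q] k q by simp
qed

lemma simple_set_system_greedy_bad: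
  assumes "n \<ge> (1::nat)"
  shows "\<exists>(\<S> :: nat set set) \<C>. simple_set_system {1..n} \<S> \<and> \<Union>\<S> = {1..n} \<and>
    greedy_output {1..n} \<S> \<C> \<and>
    real (card \<C>) > (ln (real n) / 2 - 1) * real (min_cover_size {1..n} \<S>)"
proof -
  obtain q where q: "q\<^sup>2 < n" "n \<le> (Suc q)\<^sup>2" using ceil_sqrt_exists[OF assms] by blast
  define k where "k = Suc q"
  \<comment> \<open>The first time at which nothing is left, so that all earlier blocks are
    nonempty.\<close>
  define m where "m = (LEAST m. rest k n m = 0)"
  have k: "k \<ge> 1" "n \<le> k\<^sup>2" using q by (auto simp: k_def)
  have m: "rest k n m = 0"
    unfolding m_def using rest_eventually_0[OF k(1)] by (rule LeastI)
  have pos: "rest k n i > 0" if "i < m" for i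
    using not_less_Least[of i "\<lambda>m. rest k n m = 0"] that by (simp add: m_def)
  let ?S = "bad_system k n m" and ?C = "block k n ` {..<m}"
  have "{0<..n} = {1..n}" by auto
  then have UC: "\<Union>?C = {1..n}" using Union_blocks[of k n m] m by simp
  have greedy: "greedy_output {1..n} ?S ?C"
    using greedy_state_blocks[OF k(1) order_refl pos] UC by (simp add: greedy_output_def)
  have cov: "set_cover {1..n} ?S (residue_class k n ` {..<k})"
    by (rule set_cover_residue_classes[OF k(1)])
  have "\<Union>?S = {1..n}" using UC bad_system_subset[of k n m] by (auto simp: bad_system_def)
  moreover have "min_cover_size {1..n} ?S \<le> card (residue_class k n ` {..<k})"
    by (intro min_cover_size_le cov bad_system_subset) auto
  then have opt: "min_cover_size {1..n} ?S \<le> k"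
    using card_image_le[of "{..<k}" "residue_class k n"] by simp
  have "m \<noteq> 0"
  proof
    assume "m = 0"
    then show False using m assms by simp
  qed
  have "(ln (real n) / 2 - 1) * real (min_cover_size {1..n} ?S) < real m"
  proof (cases "ln (real n) / 2 - 1 < 0")
    case True
    then have "(ln (real n) / 2 - 1) * real (min_cover_size {1..n} ?S) \<le> 0"
      by (intro mult_nonpos_nonneg) auto
    then show ?thesis using \<open>m \<noteq> 0\<close> by simp
  next
    case False
    then have "n \<noteq> 1" by auto
    then have "q \<noteq> 0" using q by (cases "q = 0") auto
    then have lower: "real q * (ln (real n) / 2) \<le> real m"
      using q assms m by (intro rest_0_imp_ge) (auto simp: k_def)
    \<comment> \<open>Passing from \<open>q\<close> to \<open>k = q + 1\<close> costs an extra ln n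
      / 2. This is at most ln k < k, so the \<open>- 1\<close> in the factor, worth
      \<open>k\<close>, pays for it.\<close>
    have "real n \<le> real k ^ 2" using k(2) by (simp flip: of_nat_power)
    then have "ln (real n) \<le> ln (real k ^ 2)" using k assms by (subst ln_le_cancel_iff) auto
    then have "ln (real n) / 2 \<le> ln (real k)" using k by (simp add: ln_realpow)
    also have "\<dots> < real k" using k by (intro ln_less_self) simp
    finally have small: "ln (real n) / 2 < real k" .
    have "(ln (real n) / 2 - 1) * real (min_cover_size {1..n} ?S) \<le> (ln (real n) / 2 - 1) * real k"
      using False opt by (intro mult_left_mono) auto
    also have "\<dots> = real q * (ln (real n) / 2) + ln (real n) / 2 - real k"
      by (simp add: k_def algebra_simps)
    also have "\<dots> < real m" using lower small by linarith
    finally show ?thesis .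
  qed
  ultimately show ?thesis
    using simple_bad_system[OF k, of m] greedy card_blocks[OF k(1) pos] by metis
qed

theorem theorem1p4:
  fixes n :: nat
  assumes "n \<ge> 1"
  shows "(\<forall>\<S> :: nat set set. simple_set_system {1..n} \<S> \<and> \<Union>\<S> = {1..n} \<longrightarrow>
            (\<exists>\<C>. greedy_output {1..n} \<S> \<C>) \<and>
            (\<forall>\<C>. greedy_output {1..n} \<S> \<C> \<longrightarrow>
               set_cover {1..n} \<S> \<C> \<and>
               real (card \<C>) \<le> (ln (real n) / 2 + 1) * real (min_cover_size {1..n} \<S>)))
       \<and> (\<exists>(\<S> :: nat set set) \<C>. simple_set_system {1..n} \<S> \<and> \<Union>\<S> = {1..n} \<and>
            greedy_output {1..n} \<S> \<C> \<and>
            real (card \<C>) > (ln (real n) / 2 - 1) * real (min_cover_size {1..n} \<S>))"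
proof (intro conjI allI impI)
  fix \<S> :: "nat set set" assume S: "simple_set_system {1..n} \<S> \<and> \<Union>\<S> = {1..n}"
  then have sub: "\<S> \<subseteq> Pow {1..n}" by (simp add: simple_set_system_def)
  show "\<exists>\<C>. greedy_output {1..n} \<S> \<C>" using S sub by (intro greedy_output_exists) auto
  fix \<C> assume C: "greedy_output {1..n} \<S> \<C>"
  then show "set_cover {1..n} \<S> \<C>"
    using greedy_state_subset by (auto simp: greedy_output_def set_cover_def)
  obtain \<O> where "set_cover {1..n} \<S> \<O>" "card \<O> = min_cover_size {1..n} \<S>"
    using min_cover_size_attained[of "{1..n}" \<S>] S sub by auto
  then show "real (card \<C>) \<le> (ln (real n) / 2 + 1) * real (min_cover_size {1..n} \<S>)"
    using simple_greedy_output_card_le[of "{1..n}" \<S> \<O> \<C>] S C assms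
    by (auto simp: greedy_output_def)
qed (rule simple_set_system_greedy_bad[OF assms])

end
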